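(* Given a word $T$ over a totally ordered alphabet, one can decide whether $T$ is a Galois word in $O(|T|)$ time using $O(1)$ additional working space.
   Context: Alternating order: for words $S,T$ with $S^\omega\neq T^\omega$ ($X^\omega$ is the infinite repetition of $X$), let $j$ be the first position with $S^\omega[j]\neq T^\omega[j]$; then $S\prec_{\mathrm{alt}}T$ if either $j$ is odd and $S^\omega[j]<T^\omega[j]$, or $j$ is even and $S^\omega[j]>T^\omega[j]$. A word is Galois if it is strictly smaller, with respect to $\prec_{\mathrm{alt}}$, than all its other cyclic rotations; in particular a Galois word is primitive (not of the form $U^k$ with $k\ge 2$). The model of computation is the word RAM with read-only access to $T$ and constant-time symbol comparisons. *)

theory Defs
  imports Complex_Main "HOL-Library.Omega_Words_Fun" "HOL-Library.Landau_Symbols"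
begin

section \<open>Galois words\<close>

text \<open>
  Infinite words are functions on \<^typ>\<open>nat\<close>, hence indexed from \<open>0\<close>: an odd position
  of the usual indexing from \<open>1\<close> is an even index \<open>j\<close> here. The order is only meaningful
  for nonempty words, since \<^term>\<open>iter []\<close> is unspecified.
\<close>

definition alt_less :: "'a::linorder list \<Rightarrow> 'a list \<Rightarrow> bool"  (infix "\<prec>\<^sub>a\<^sub>l\<^sub>t" 50) where
  "S \<prec>\<^sub>a\<^sub>l\<^sub>t T \<longleftrightarrow> S\<^sup>\<omega> \<noteq> T\<^sup>\<omega> \<and>
     (let j = (LEAST i. S\<^sup>\<omega> i \<noteq> T\<^sup>\<omega> i) in
        (even j \<and> S\<^sup>\<omega> j < T\<^sup>\<omega> j) \<or> (odd j \<and> S\<^sup>\<omega> j > T\<^sup>\<omega> j))"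

text \<open>
  The other rotations are those by a nontrivial offset, even if they happen to equal \<open>T\<close>
  as words. Hence a proper power is not Galois. Neither is the empty word.
\<close>

definition galois :: "'a::linorder list \<Rightarrow> bool" where
  "galois T \<longleftrightarrow> T \<noteq> [] \<and> (\<forall>k. 0 < k \<and> k < length T \<longrightarrow> T \<prec>\<^sub>a\<^sub>l\<^sub>t rotate k T)"


section \<open>Word RAM with a read-only input word\<close>

text \<open>
  The working memory consists of cells, each holding a number below \<open>2 ^ w\<close>, where \<open>w\<close> is
  the word length. Operands of instructions are cell addresses; \<open>Load\<close> and \<open>Store\<close> address
  a cell indirectly. The input word is not stored in the memory: it is accessible only
  through its length and through comparisons of the symbols at two positions, which are
  numbered from \<open>0\<close> and held in memory cells.
\<close>

type_synonym memory = "nat \<Rightarrow> nat"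

datatype binop = Add | Sub | Mult | Div | Mod | And | Or | Xor | Shl | Shr

datatype instr =
    Const nat nat            \<comment> \<open>\<open>M[d] := c\<close>\<close>
  | Input_Length nat         \<comment> \<open>\<open>M[d] := |T|\<close>\<close>
  | Arith binop nat nat nat  \<comment> \<open>\<open>M[d] := M[a] op M[b]\<close>\<close>
  | Load nat nat             \<comment> \<open>\<open>M[d] := M[M[a]]\<close>\<close>
  | Store nat nat            \<comment> \<open>\<open>M[M[d]] := M[a]\<close>\<close>
  | Jump nat                 \<comment> \<open>\<open>goto l\<close>\<close>
  | Jump_Less nat nat nat    \<comment> \<open>\<open>if M[a] < M[b] then goto l\<close>\<close>
  | Jump_Eq nat nat nat      \<comment> \<open>\<open>if M[a] = M[b] then goto l\<close>\<close>
  | Jump_Sym_Less nat nat nat  \<comment> \<open>\<open>if T[M[a]] < T[M[b]] then goto l\<close>\<close>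
  | Jump_Sym_Eq nat nat nat    \<comment> \<open>\<open>if T[M[a]] = T[M[b]] then goto l\<close>\<close>
  | Halt bool                \<comment> \<open>stop with the given answer\<close>

type_synonym program = "instr list"

text \<open>Results are reduced modulo \<open>2 ^ w\<close> when written; subtraction wraps around.\<close>

fun binop_val :: "nat \<Rightarrow> binop \<Rightarrow> nat \<Rightarrow> nat \<Rightarrow> nat" where
  "binop_val w Add x y = x + y"
| "binop_val w Sub x y = (x + 2 ^ w) - y"
| "binop_val w Mult x y = x * y"
| "binop_val w Div x y = x div y"
| "binop_val w Mod x y = x mod y"
| "binop_val w And x y = and x y"
| "binop_val w Or x y = or x y"
| "binop_val w Xor x y = xor x y"
| "binop_val w Shl x y = push_bit y x"
| "binop_val w Shr x y = drop_bit y x"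

definition store :: "nat \<Rightarrow> memory \<Rightarrow> nat \<Rightarrow> nat \<Rightarrow> memory" where
  "store w M d v = M(d := v mod 2 ^ w)"

text \<open>
  One step from program counter \<open>p\<close> and memory \<open>M\<close>. There is no successor on \<open>Halt\<close> or on
  a symbol comparison outside the input word.
\<close>

fun exec :: "nat \<Rightarrow> 'a::linorder list \<Rightarrow> instr \<Rightarrow> nat \<Rightarrow> memory \<Rightarrow> (nat \<times> memory) option" where
  "exec w T (Const d c) p M = Some (p + 1, store w M d c)"
| "exec w T (Input_Length d) p M = Some (p + 1, store w M d (length T))"
| "exec w T (Arith f d a b) p M = Some (p + 1, store w M d (binop_val w f (M a) (M b)))"
| "exec w T (Load d a) p M = Some (p + 1, store w M d (M (M a)))"
| "exec w T (Store d a) p M = Some (p + 1, store w M (M d) (M a))"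
| "exec w T (Jump l) p M = Some (l, M)"
| "exec w T (Jump_Less a b l) p M = Some (if M a < M b then l else p + 1, M)"
| "exec w T (Jump_Eq a b l) p M = Some (if M a = M b then l else p + 1, M)"
| "exec w T (Jump_Sym_Less a b l) p M =
     (if M a < length T \<and> M b < length T
      then Some (if T ! M a < T ! M b then l else p + 1, M) else None)"
| "exec w T (Jump_Sym_Eq a b l) p M =
     (if M a < length T \<and> M b < length T
      then Some (if T ! M a = T ! M b then l else p + 1, M) else None)"
| "exec w T (Halt r) p M = None"

text \<open>The addresses of the memory cells that an instruction reads or writes.\<close>

fun touched :: "instr \<Rightarrow> memory \<Rightarrow> nat set" where
  "touched (Const d c) M = {d}"
| "touched (Input_Length d) M = {d}"
| "touched (Arith f d a b) M = {d, a, b}"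
| "touched (Load d a) M = {d, a, M a}"
| "touched (Store d a) M = {d, M d, a}"
| "touched (Jump l) M = {}"
| "touched (Jump_Less a b l) M = {a, b}"
| "touched (Jump_Eq a b l) M = {a, b}"
| "touched (Jump_Sym_Less a b l) M = {a, b}"
| "touched (Jump_Sym_Eq a b l) M = {a, b}"
| "touched (Halt r) M = {}"

text \<open>
  \<open>run w P T p M t A r\<close>: started at program counter \<open>p\<close> with memory \<open>M\<close>, the program \<open>P\<close>
  halts with answer \<open>r\<close> after \<open>t\<close> instructions, having touched exactly the cells in \<open>A\<close>.
  Leaving the program without \<open>Halt\<close> yields no answer.
\<close>

inductive run :: "nat \<Rightarrow> program \<Rightarrow> 'a::linorder list \<Rightarrow>
    nat \<Rightarrow> memory \<Rightarrow> nat \<Rightarrow> nat set \<Rightarrow> bool \<Rightarrow> bool"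
  for w :: nat and P :: program and T :: "'a list" where
  halt: "p < length P \<Longrightarrow> P ! p = Halt r \<Longrightarrow> run w P T p M 1 {} r"
| step: "p < length P \<Longrightarrow> exec w T (P ! p) p M = Some (p', M') \<Longrightarrow>
         run w P T p' M' t A r \<Longrightarrow>
         run w P T p M (Suc t) (touched (P ! p) M \<union> A) r"

lemma run_deterministic:
  assumes "run w P T p M t A r" and "run w P T p M t' A' r'"
  shows "t = t' \<and> A = A' \<and> r = r'"
  using assms
proof (induction arbitrary: t' A' r' rule: run.induct)
  case (halt p r M)
  from halt(3,1,2) show ?case by cases auto
next
  case (step p M p' M' t A r)
  from step.prems show ?case
  proof cases
    case halt
    with step.hyps show ?thesis by simp
  next
    case (step p'' M'' s B)
    with step.hyps step.IH show ?thesis by auto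
  qed
qed

text \<open>
  A program decides a property of words within given time and space bounds, as functions of
  the length of the input, if it does so for every word length large enough to hold the
  length of the input, starting from a zero-initialised memory. A space bound of \<open>s\<close> cells
  means that only the cells with addresses below \<open>s\<close> are touched.
\<close>

definition decides_within ::
    "program \<Rightarrow> ('a::linorder list \<Rightarrow> bool) \<Rightarrow> (nat \<Rightarrow> nat) \<Rightarrow> (nat \<Rightarrow> nat) \<Rightarrow> bool" where
  "decides_within P Q time space \<longleftrightarrow>
     (\<forall>T w. length T < 2 ^ w \<longrightarrow>
        (\<exists>t A. run w P T 0 (\<lambda>_. 0) t A (Q T) \<and>
           t \<le> time (length T) \<and> A \<subseteq> {..<space (length T)}))"

end

theory Submission
  imports Defs
begin

text \<open>
  Call a rotation minimal if no rotation is smaller. A word is Galois iff none of its nontrivial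
  rotations is minimal. Compare \<open>T\<close> with its rotation by \<open>s\<close> and let \<open>d\<close> be the first mismatch
  (position from \<open>0\<close>) of the infinite repetitions. If there is none, or if \<open>T\<close> is the larger one,
  \<open>T\<close> is not Galois. Otherwise drop a common even number \<open>p \<le> d\<close> of leading symbols: parities
  of positions are kept, so the rotation by \<open>s + p\<close> is larger than the one by \<open>p\<close>, hence not
  minimal. So the next offset of the same parity that needs a test is \<open>s + 2 (d div 2) + 2\<close>.
  A test costs \<open>O(d + 1)\<close> and advances \<open>s\<close> by at least \<open>d + 1\<close>, so that one pass over the odd
  and one over the even offsets take linear time, with a constant number of indices.
\<close>

section \<open>The alternating order on infinite words\<close>

definition alt_at :: "('a::linorder) word \<Rightarrow> 'a word \<Rightarrow> nat \<Rightarrow> bool" where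
  "alt_at f g d \<longleftrightarrow> (\<forall>i<d. f i = g i) \<and> (if even d then f d < g d else g d < f d)"

definition omega_less :: "('a::linorder) word \<Rightarrow> 'a word \<Rightarrow> bool" where
  "omega_less f g \<longleftrightarrow> (\<exists>d. alt_at f g d)"

lemma omega_less_irrefl: "\<not> omega_less f f"
  by (auto simp: omega_less_def alt_at_def split: if_splits)

text \<open>The earlier mismatch decides. If both fall on the same position, its parity fixes one
  direction, in which the order of symbols is transitive.\<close>

lemma alt_at_trans:
  assumes "alt_at f g d" and "alt_at g h e"
  shows "alt_at f h (min d e)"
proof (cases d e rule: linorder_cases)
  case less
  then show ?thesis using assms unfolding alt_at_def by (auto split: if_splits)
next
  case equal
  then show ?thesis using assms unfolding alt_at_def by (auto split: if_splits)
next
  case greater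
  then show ?thesis using assms unfolding alt_at_def by (auto split: if_splits)
qed

lemma omega_less_trans: "omega_less f g \<Longrightarrow> omega_less g h \<Longrightarrow> omega_less f h"
  unfolding omega_less_def by (blast intro: alt_at_trans)

lemma first_mismatch:
  fixes f g :: "('a::linorder) word"
  assumes "f k \<noteq> g k"
  obtains d where "d \<le> k" "\<forall>i<d. f i = g i" "f d \<noteq> g d"
    "alt_at f g d \<or> alt_at g f d"
proof -
  define d where "d = (LEAST i. f i \<noteq> g i)"
  have "f d \<noteq> g d" unfolding d_def using assms by (rule LeastI)
  moreover have "\<forall>i<d. f i = g i" unfolding d_def using not_less_Least by blast
  moreover have "d \<le> k" unfolding d_def using assms by (rule Least_le)
  moreover have "alt_at f g d \<or> alt_at g f d"
    using calculation by (auto simp: alt_at_def)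
  ultimately show thesis using that by blast
qed

lemma omega_less_linear: "f \<noteq> g \<Longrightarrow> omega_less f g \<or> omega_less g f"
proof -
  assume "f \<noteq> g"
  then obtain k where "f k \<noteq> g k" by auto
  then show ?thesis unfolding omega_less_def by (rule first_mismatch) blast
qed

lemma alt_less_iff: "S \<prec>\<^sub>a\<^sub>l\<^sub>t T \<longleftrightarrow> omega_less (S\<^sup>\<omega>) (T\<^sup>\<omega>)"
proof
  assume A: "S \<prec>\<^sub>a\<^sub>l\<^sub>t T"
  define j where "j = (LEAST i. S\<^sup>\<omega> i \<noteq> T\<^sup>\<omega> i)"
  have "\<forall>i<j. S\<^sup>\<omega> i = T\<^sup>\<omega> i" unfolding j_def using not_less_Least by blast
  moreover have "if even j then S\<^sup>\<omega> j < T\<^sup>\<omega> j else T\<^sup>\<omega> j < S\<^sup>\<omega> j"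
    using A unfolding alt_less_def Let_def j_def[symmetric] by presburger
  ultimately show "omega_less (S\<^sup>\<omega>) (T\<^sup>\<omega>)" unfolding omega_less_def alt_at_def by blast
next
  assume "omega_less (S\<^sup>\<omega>) (T\<^sup>\<omega>)"
  then obtain d where d: "alt_at (S\<^sup>\<omega>) (T\<^sup>\<omega>) d" unfolding omega_less_def by blast
  then have "(LEAST i. S\<^sup>\<omega> i \<noteq> T\<^sup>\<omega> i) = d"
    unfolding alt_at_def by (intro Least_equality) (auto split: if_splits intro: leI)
  then show "S \<prec>\<^sub>a\<^sub>l\<^sub>t T" using d unfolding alt_less_def alt_at_def Let_def
    by (auto split: if_splits)
qed

lemma alt_at_suffix:
  assumes "alt_at f g d" and "even p" and "p \<le> d"
  shows "alt_at (suffix p f) (suffix p g) (d - p)"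
  using assms unfolding alt_at_def by (auto split: if_splits)

section \<open>Minimal rotations and the Galois property\<close>

lemma iter_rotate:
  assumes "T \<noteq> []"
  shows "(rotate k T)\<^sup>\<omega> = suffix k (T\<^sup>\<omega>)"
  using assms by (auto simp: iter_def nth_rotate fun_eq_iff mod_simps)

lemma suffix_iter_mod: "T \<noteq> [] \<Longrightarrow> suffix (k mod length T) (T\<^sup>\<omega>) = suffix k (T\<^sup>\<omega>)"
  by (auto simp: iter_def fun_eq_iff mod_simps)

lemma galois_iff:
  assumes "T \<noteq> []"
  shows "galois T \<longleftrightarrow> (\<forall>s. 0 < s \<and> s < length T \<longrightarrow> omega_less (T\<^sup>\<omega>) (suffix s (T\<^sup>\<omega>)))"
  using assms by (auto simp: galois_def alt_less_iff iter_rotate)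

definition nonminimal :: "('a::linorder) list \<Rightarrow> nat \<Rightarrow> bool" where
  "nonminimal T s \<longleftrightarrow> (\<exists>p. omega_less (suffix p (T\<^sup>\<omega>)) (suffix s (T\<^sup>\<omega>)))"

text \<open>Among finitely many rotations one is minimal. The assumption excludes every offset but
  \<open>0\<close>, so \<open>T\<close> itself is minimal, and strictly so.\<close>

lemma galois_if_nonminimal:
  fixes T :: "('a::linorder) list"
  assumes ne: "T \<noteq> []" and nm: "\<And>s. 0 < s \<Longrightarrow> s < length T \<Longrightarrow> nonminimal T s"
  shows "galois T"
proof -
  define X where "X = (\<lambda>s. suffix s (T\<^sup>\<omega>))"
  define R where "R = (\<lambda>s t. omega_less (X s) (X t))"
  have "\<exists>m\<in>{..<length T}. \<forall>x\<in>{..<length T}. x \<noteq> m \<longrightarrow> \<not> R x m"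
  proof (rule Finite_Set.bex_min_element)
    show "asymp_on {..<length T} R"
      by (rule asymp_onI) (metis R_def omega_less_trans omega_less_irrefl)
    show "transp_on {..<length T} R"
      by (rule transp_onI) (metis R_def omega_less_trans)
  qed (use ne in \<open>auto simp: lessThan_empty_iff\<close>)
  then obtain m where m: "m < length T" "\<And>x. x < length T \<Longrightarrow> \<not> R x m"
    by (metis R_def lessThan_iff omega_less_irrefl)
  have min: "\<not> omega_less (X p) (X m)" for p
    using m(2)[of "p mod length T"] ne by (simp add: R_def X_def suffix_iter_mod)
  have "m = 0" using nm[of m] m(1) min by (auto simp: nonminimal_def X_def)
  show ?thesis unfolding galois_iff[OF ne]
  proof (intro allI impI)
    fix s assume s: "0 < s \<and> s < length T"
    then obtain p where "omega_less (X p) (X s)"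
      using nm[of s] by (auto simp: nonminimal_def X_def)
    \<comment> \<open>If \<open>X s\<close> were equal to \<open>X 0\<close> or below it, then
      \<open>X p\<close> or \<open>X s\<close> would lie below the minimal
      \<open>X 0\<close>.\<close>
    then have "omega_less (X 0) (X s)"
      using min[of p] min[of s] omega_less_linear[of "X 0" "X s"] \<open>m = 0\<close> by metis
    then show "omega_less (T\<^sup>\<omega>) (suffix s (T\<^sup>\<omega>))" by (simp add: X_def)
  qed
qed

lemma nonminimal_skip:
  assumes "alt_at (T\<^sup>\<omega>) (suffix s (T\<^sup>\<omega>)) d" and "even p" and "p \<le> d"
  shows "nonminimal T (s + p)"
  using alt_at_suffix[OF assms] unfolding nonminimal_def omega_less_def
  by (auto simp: add.commute)

section \<open>The program\<close>

text \<open>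
  Cells: \<open>0\<close> length \<open>n\<close> of the word, \<open>1\<close> offset \<open>s\<close>, \<open>2\<close> index \<open>i\<close>, \<open>3\<close> index
  \<open>j = (s + i) mod n\<close>, \<open>4\<close> constant \<open>1\<close>, \<open>5\<close> flag for the second pass, \<open>6\<close> constant \<open>0\<close>,
  \<open>7\<close> constant \<open>2\<close>, \<open>8\<close> parity of \<open>i\<close>. No intermediate result exceeds \<open>n\<close>, since nothing larger
  need fit into a cell: \<open>s\<close> is advanced via \<open>j\<close>, and \<open>j < s\<close> signals that \<open>s + i \<ge> n\<close>. The
  constant \<open>2\<close> is used only if \<open>n \<ge> 2\<close>.
\<close>

definition prog :: program where
  "prog = [
    Input_Length 0,
    Jump_Eq 0 6 32,
    Const 4 1,
    Const 1 1,
    Jump_Less 1 0 6,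
    Halt True,
    Const 7 2,
    \<comment> \<open>7: test the offset \<open>s\<close>\<close>
    Jump_Less 1 0 12,
    \<comment> \<open>8: end of a pass\<close>
    Jump_Eq 5 4 5,
    Const 5 1,
    Const 1 2,
    Jump 7,
    Const 2 0,
    Arith Add 3 1 6,
    \<comment> \<open>14: compare the symbols at \<open>i\<close> and \<open>j\<close>\<close>
    Jump_Sym_Eq 2 3 26,
    Arith Mod 8 2 7,
    Jump_Eq 8 6 19,
    Jump_Sym_Less 2 3 32,
    Jump 23,
    \<comment> \<open>19: mismatch at an even \<open>i\<close>\<close>
    Jump_Sym_Less 3 2 32,
    Jump_Less 3 1 8,
    Arith Add 3 3 4,
    Jump_Eq 3 0 8,
    \<comment> \<open>23: advance \<open>s\<close> to \<open>j + 1\<close>\<close>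
    Jump_Less 3 1 8,
    Arith Add 1 3 4,
    Jump 7,
    \<comment> \<open>26: match\<close>
    Arith Add 2 2 4,
    Jump_Eq 2 0 32,
    Arith Add 3 3 4,
    Jump_Less 3 0 14,
    Const 3 0,
    Jump 14,
    Halt False]"

lemma length_prog: "length prog = 33"
  by (simp add: prog_def)

lemma prog_nth:
  "prog ! 0 = Input_Length 0" "prog ! Suc 0 = Jump_Eq 0 6 32" "prog ! 2 = Const 4 1"
  "prog ! 3 = Const 1 1" "prog ! 4 = Jump_Less 1 0 6" "prog ! 5 = Halt True"
  "prog ! 6 = Const 7 2" "prog ! 7 = Jump_Less 1 0 12" "prog ! 8 = Jump_Eq 5 4 5"
  "prog ! 9 = Const 5 1" "prog ! 10 = Const 1 2" "prog ! 11 = Jump 7"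
  "prog ! 12 = Const 2 0" "prog ! 13 = Arith Add 3 1 6" "prog ! 14 = Jump_Sym_Eq 2 3 26"
  "prog ! 15 = Arith Mod 8 2 7" "prog ! 16 = Jump_Eq 8 6 19" "prog ! 17 = Jump_Sym_Less 2 3 32"
  "prog ! 18 = Jump 23" "prog ! 19 = Jump_Sym_Less 3 2 32" "prog ! 20 = Jump_Less 3 1 8"
  "prog ! 21 = Arith Add 3 3 4" "prog ! 22 = Jump_Eq 3 0 8" "prog ! 23 = Jump_Less 3 1 8"
  "prog ! 24 = Arith Add 1 3 4" "prog ! 25 = Jump 7" "prog ! 26 = Arith Add 2 2 4"
  "prog ! 27 = Jump_Eq 2 0 32" "prog ! 28 = Arith Add 3 3 4" "prog ! 29 = Jump_Less 3 0 14"
  "prog ! 30 = Const 3 0" "prog ! 31 = Jump 14" "prog ! 32 = Halt False"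
  by (simp_all add: prog_def)

section \<open>Symbolic execution with a step budget\<close>

definition halts :: "nat \<Rightarrow> 'a::linorder list \<Rightarrow> nat \<Rightarrow> memory \<Rightarrow> nat \<Rightarrow> bool \<Rightarrow> bool" where
  "halts w T p M b r \<longleftrightarrow> (\<exists>t A. run w prog T p M t A r \<and> t \<le> b \<and> A \<subseteq> {..<9})"

lemma halts_mono: "halts w T p M b r \<Longrightarrow> b \<le> b' \<Longrightarrow> halts w T p M b' r"
  unfolding halts_def by (meson le_trans)

text \<open>Executes one instruction symbolically. Instantiating \<open>p\<close> with fixed program
  counters keeps the simplifier from unrolling the loops.\<close>

lemma halts_unfold:
  assumes "p < 33" and "0 < b"
  shows "halts w T p M b r \<longleftrightarrow>
    (case exec w T (prog ! p) p M of
       None \<Rightarrow> prog ! p = Halt r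
     | Some (p', M') \<Rightarrow> touched (prog ! p) M \<subseteq> {..<9} \<and> halts w T p' M' (b - 1) r)"
    (is "?L \<longleftrightarrow> ?R")
proof
  assume ?L
  then obtain t A where tA: "run w prog T p M t A r" "t \<le> b" "A \<subseteq> {..<9}"
    unfolding halts_def by blast
  from tA(1) show ?R
  proof cases
    case (step p' M' t' A')
    with tA have "halts w T p' M' (b - 1) r" unfolding halts_def
      by (intro exI[of _ t'] exI[of _ A']) auto
    with step tA(3) show ?thesis by auto
  qed auto
next
  assume R: ?R
  show ?L
  proof (cases "exec w T (prog ! p) p M")
    case None
    with R assms have "run w prog T p M 1 {} r"
      using run.halt[of p prog r w T M] by (simp add: length_prog)
    with assms(2) show ?thesis unfolding halts_def by (intro exI[of _ 1] exI[of _ "{}"]) auto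
  next
    case (Some c)
    then obtain p' M' where c: "exec w T (prog ! p) p M = Some (p', M')" by (cases c) auto
    with R obtain t A where "run w prog T p' M' t A r" "t \<le> b - 1" "A \<subseteq> {..<9}"
      unfolding halts_def by auto
    with c R assms show ?thesis unfolding halts_def
      by (intro exI[of _ "Suc t"] exI[of _ "touched (prog ! p) M \<union> A"])
         (auto intro!: run.step simp: length_prog)
  qed
qed

text \<open>The states after initialisation: cells \<open>4\<close> and \<open>7\<close> hold their
  constants, and cell \<open>6\<close> keeps its initial zero.\<close>

definition mem :: "nat \<Rightarrow> nat \<Rightarrow> nat \<Rightarrow> nat \<Rightarrow> nat \<Rightarrow> nat \<Rightarrow> memory" where
  "mem n s i j f q = (\<lambda>_. 0)(0 := n, 1 := s, 2 := i, 3 := j, 4 := 1, 5 := f, 7 := 2, 8 := q)"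

lemma mem_simps [simp]:
  "mem n s i j f q 0 = n" "mem n s i j f q (Suc 0) = s" "mem n s i j f q 2 = i"
  "mem n s i j f q 3 = j" "mem n s i j f q 4 = 1" "mem n s i j f q 5 = f"
  "mem n s i j f q 6 = 0" "mem n s i j f q 7 = 2" "mem n s i j f q 8 = q"
  by (simp_all add: mem_def)

lemma store_mem [simp]:
  assumes "v < 2 ^ w"
  shows "store w (mem n s i j f q) (Suc 0) v = mem n v i j f q"
    "store w (mem n s i j f q) 2 v = mem n s v j f q"
    "store w (mem n s i j f q) 3 v = mem n s i v f q"
    "store w (mem n s i j f q) 5 v = mem n s i j v q"
    "store w (mem n s i j f q) 8 v = mem n s i j f v"
  using assms by (simp_all add: mem_def store_def fun_eq_iff)

section \<open>Testing one offset\<close>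

context
  fixes T :: "'a::linorder list" and w n :: nat
  assumes len: "length T = n" and n2: "2 \<le> n" and nw: "n < 2 ^ w"
begin

lemma ne: "T \<noteq> []"
  using len n2 by auto

lemma iter_T: "T\<^sup>\<omega> k = T ! (k mod n)"
  using ne by (simp add: iter_def len)

lemma small: "x \<le> n \<Longrightarrow> x < 2 ^ w"
  using nw by simp

lemmas exec_rules = prog_nth len small

text \<open>The longest way round the loop, with \<open>j\<close> wrapping to \<open>0\<close>,
  takes 7 instructions.\<close>

lemma match_step:
  assumes "halts w T 14 (mem n s (Suc i) ((s + Suc i) mod n) f q) b r"
    and "Suc i < n" and "T\<^sup>\<omega> i = T\<^sup>\<omega> (s + i)"
  shows "halts w T 14 (mem n s i ((s + i) mod n) f q) (b + 7) r"
proof -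
  define j where "j = (s + i) mod n"
  have j: "j < n" "T ! i = T ! j" using assms n2 by (auto simp: j_def iter_T)
  have "(s + Suc i) mod n = (if Suc j < n then Suc j else 0)"
    using j(1) by (simp add: j_def mod_Suc)
  then have "halts w T 26 (mem n s i j f q) (b + 6) r"
    using halts_mono[OF assms(1)] assms(2) j(1)
    by (cases "Suc j < n")
      (simp_all add: halts_unfold[of 26] halts_unfold[of 27] halts_unfold[of 28]
        halts_unfold[of 29] halts_unfold[of 30] halts_unfold[of 31] exec_rules)
  then show ?thesis
    using j assms(2) by (simp add: halts_unfold[of 14] exec_rules add.commute[of b] flip: j_def)
qed

text \<open>The induction goes backwards from the mismatch \<open>d\<close>, as \<open>halts\<close>
  speaks about the rest of the run.\<close>

lemma match_steps:
  assumes "halts w T 14 (mem n s d ((s + d) mod n) f q) b r"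
    and "d < n" and "\<forall>i<d. T\<^sup>\<omega> i = T\<^sup>\<omega> (s + i)" and "k \<le> d"
  shows "halts w T 14 (mem n s (d - k) ((s + (d - k)) mod n) f q) (b + 7 * k) r"
  using assms(4)
proof (induction k)
  case 0
  then show ?case using assms(1) by simp
next
  case (Suc k)
  have eq: "d - k = Suc (d - Suc k)" using Suc.prems by simp
  show ?case
    using match_step[of s "d - Suc k" f q "b + 7 * k" r] Suc assms(2,3) by (simp add: eq add_ac)
qed

lemma test_offset:
  assumes "halts w T 14 (mem n s d ((s + d) mod n) f q) b r"
    and "d < n" and "\<forall>i<d. T\<^sup>\<omega> i = T\<^sup>\<omega> (s + i)" and "s < n"
  shows "halts w T 7 (mem n s i j f q) (b + 7 * d + 3) r"
  using match_steps[OF assms(1-3), of d] assms(4)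
  by (simp add: halts_unfold[of 7] halts_unfold[of 12] halts_unfold[of 13] exec_rules)

lemma test_equal:
  assumes "s < n" and "\<forall>i<n. T\<^sup>\<omega> i = T\<^sup>\<omega> (s + i)"
  shows "halts w T 7 (mem n s i j f q) (7 * n + 3) False"
proof -
  \<comment> \<open>The match of the last symbol raises \<open>i\<close> to \<open>n\<close>, which
    makes the program reject.\<close>
  have "T ! (n - 1) = T ! ((s + (n - 1)) mod n)"
    using assms(2)[rule_format, of "n - 1"] n2 by (simp add: iter_T)
  then have "halts w T 14 (mem n s (n - 1) ((s + (n - 1)) mod n) f q) 6 False"
    using n2 by (simp add: halts_unfold[of 14] halts_unfold[of 26] halts_unfold[of 27]
      halts_unfold[of 32] exec_rules)
  then have "halts w T 7 (mem n s i j f q) (6 + 7 * (n - 1) + 3) False"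
    by (rule test_offset) (use assms n2 in auto)
  then show ?thesis by (rule halts_mono) (use n2 in auto)
qed

lemma test_larger:
  assumes "s < n" and "d < n" and "alt_at (suffix s (T\<^sup>\<omega>)) (T\<^sup>\<omega>) d"
  shows "halts w T 7 (mem n s i j f q) (7 * n + 3) False"
proof -
  define k where "k = (s + d) mod n"
  have k: "k < n" using n2 by (simp add: k_def)
  have lt: "if even d then T ! k < T ! d else T ! d < T ! k"
    using assms(2,3) by (auto simp: alt_at_def iter_T k_def)
  then have "halts w T 14 (mem n s d k f q) 6 False"
    using n2 k assms(2)
    by (cases "even d")
      (auto simp: halts_unfold[of 14] halts_unfold[of 15] halts_unfold[of 16]
      halts_unfold[of 17] halts_unfold[of 19] halts_unfold[of 32] exec_rules
      even_iff_mod_2_eq_zero odd_iff_mod_2_eq_one)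
  then have "halts w T 7 (mem n s i j f q) (6 + 7 * d + 3) False"
    unfolding k_def by (rule test_offset) (use assms in \<open>auto simp: alt_at_def\<close>)
  then show ?thesis by (rule halts_mono) (use assms(2) in auto)
qed

text \<open>Without wraparound \<open>k = s + d\<close>, so \<open>s'\<close> is
  \<open>k + 2\<close> for even \<open>d\<close> and \<open>k + 1\<close> for odd \<open>d\<close>.
  With wraparound \<open>k < s\<close>, and \<open>s'\<close> lies beyond \<open>n\<close>.\<close>

lemma test_smaller:
  assumes "s < n" and "d < n" and "alt_at (T\<^sup>\<omega>) (suffix s (T\<^sup>\<omega>)) d"
    and s': "s' = s + 2 * (d div 2) + 2"
    and next_offset: "\<And>i j q. s' < n \<Longrightarrow> halts w T 7 (mem n s' i j f q) b r"
    and end_pass: "\<And>s i j q. n \<le> s' \<Longrightarrow> halts w T 8 (mem n s i j f q) b r"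
  shows "halts w T 7 (mem n s i j f q) (b + 7 * d + 14) r"
proof -
  define k where "k = (s + d) mod n"
  have k: "k < n" using n2 by (simp add: k_def)
  have lt: "if even d then T ! d < T ! k else T ! k < T ! d"
    using assms(2,3) by (auto simp: alt_at_def iter_T k_def)
  then have neq: "T ! d \<noteq> T ! k" by (auto split: if_splits)
  \<comment> \<open>If \<open>s'\<close> is out of range, the test at \<open>7\<close> falls through
    to the end of the pass, at the cost of one more instruction.\<close>
  have next_offset': "halts w T 7 (mem n s' i j f q) c r" if "b < c" for i j q c
  proof (cases "s' < n")
    case True
    then show ?thesis by (rule halts_mono[OF next_offset]) (use that in simp)
  next
    case False
    with halts_mono[OF end_pass] that show ?thesis
      by (simp add: halts_unfold[of 7] exec_rules)
  qed
  have "halts w T 14 (mem n s d k f q) (b + 11) r"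
  proof (cases "s + d < n")
    case True
    then have k': "k = s + d" by (simp add: k_def)
    show ?thesis
    proof (cases "even d")
      case True
      then have "s' = Suc (Suc k)" "d mod 2 = 0" using s' k' by auto
      then show ?thesis
        using lt neq k assms(2) True k' next_offset' halts_mono[OF end_pass]
        by (cases "Suc k = n") (auto simp: halts_unfold[of 14] halts_unfold[of 15]
          halts_unfold[of 16] halts_unfold[of 19] halts_unfold[of 20] halts_unfold[of 21]
          halts_unfold[of 22] halts_unfold[of 23] halts_unfold[of 24] halts_unfold[of 25]
          exec_rules)
    next
      case False
      then have "s' = Suc k" "d mod 2 = 1" using s' k' by (auto elim: oddE)
      then show ?thesis
        using lt neq k assms(2) False k' next_offset'
        by (auto simp: halts_unfold[of 14] halts_unfold[of 15]
          halts_unfold[of 16] halts_unfold[of 17] halts_unfold[of 18]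
          halts_unfold[of 23] halts_unfold[of 24] halts_unfold[of 25] exec_rules)
    qed
  next
    case False
    then have "k = s + d - n" using assms(1,2) by (simp add: k_def mod_if)
    then have k': "k < s" using False assms(1,2) by auto
    have "s + d < s'" using s' by presburger
    then have "halts w T 8 (mem n s d k f q) c r" if "b \<le> c" for q c
      using False that by (intro halts_mono[OF end_pass]) auto
    then show ?thesis
      using lt neq k assms(2) k'
      by (cases "even d") (auto simp: halts_unfold[of 14] halts_unfold[of 15]
        halts_unfold[of 16] halts_unfold[of 17] halts_unfold[of 18] halts_unfold[of 19]
        halts_unfold[of 20] halts_unfold[of 23] exec_rules
        even_iff_mod_2_eq_zero odd_iff_mod_2_eq_one)
  qed
  then have "halts w T 7 (mem n s i j f q) (b + 11 + 7 * d + 3) r"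
    unfolding k_def by (rule test_offset) (use assms in \<open>auto simp: alt_at_def\<close>)
  then show ?thesis by (simp add: add_ac)
qed

section \<open>The passes over odd and even offsets\<close>

lemma offset_not_less:
  assumes "0 < s" and "s < n" and "\<not> omega_less (T\<^sup>\<omega>) (suffix s (T\<^sup>\<omega>))"
  shows "halts w T 7 (mem n s i j f q) (7 * n + 3) (galois T)"
proof -
  have "\<not> galois T" using assms ne by (auto simp: galois_iff len)
  moreover have "halts w T 7 (mem n s i j f q) (7 * n + 3) False"
  proof (cases "\<forall>i<n. T\<^sup>\<omega> i = T\<^sup>\<omega> (s + i)")
    case True
    with test_equal assms(2) show ?thesis by blast
  next
    case False
    then obtain k where "k < n" "T\<^sup>\<omega> k \<noteq> suffix s (T\<^sup>\<omega>) k" by auto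
    then obtain d where "d < n" "alt_at (suffix s (T\<^sup>\<omega>)) (T\<^sup>\<omega>) d"
      using assms(3) unfolding omega_less_def by (metis first_mismatch le_less_trans)
    with test_larger assms(2) show ?thesis by blast
  qed
  ultimately show ?thesis by simp
qed

text \<open>Only the parity of \<open>start\<close> matters. The term \<open>14 * (n - s)\<close> is
  a potential: a test costs \<open>7 * d + 14\<close> and advances \<open>s\<close> by at least
  \<open>d + 1\<close>. The term \<open>14 * n\<close> pays for the last test.\<close>

lemma pass:
  assumes "0 < s" and "s < n"
    and "\<And>t. 0 < t \<Longrightarrow> t < s \<Longrightarrow> even (s + t) \<Longrightarrow> nonminimal T t"
    and "\<And>s i j q. (\<And>t. 0 < t \<Longrightarrow> t < n \<Longrightarrow> even (start + t) \<Longrightarrow> nonminimal T t) \<Longrightarrow>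
      halts w T 8 (mem n s i j f q) b (galois T)"
    and "even (start + s)"
  shows "halts w T 7 (mem n s i j f q) (b + 14 * (n - s) + 14 * n) (galois T)"
  using assms(1-3,5)
proof (induction "n - s" arbitrary: s i j q rule: less_induct)
  case less
  show ?case
  proof (cases "omega_less (T\<^sup>\<omega>) (suffix s (T\<^sup>\<omega>))")
    case False
    show ?thesis
      by (rule halts_mono[OF offset_not_less]) (use less.prems False n2 in auto)
  next
    case True
    then obtain e where e: "alt_at (T\<^sup>\<omega>) (suffix s (T\<^sup>\<omega>)) e" unfolding omega_less_def by blast
    \<comment> \<open>Both words have period \<open>n\<close>, so the mismatch at \<open>e\<close>
      recurs at \<open>e mod n\<close>.\<close>
    have "\<exists>k<n. T\<^sup>\<omega> k \<noteq> suffix s (T\<^sup>\<omega>) k"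
    proof (rule exI[of _ "e mod n"], intro conjI)
      show "e mod n < n" using n2 by simp
      have "T\<^sup>\<omega> e \<noteq> suffix s (T\<^sup>\<omega>) e" using e by (auto simp: alt_at_def split: if_splits)
      then show "T\<^sup>\<omega> (e mod n) \<noteq> suffix s (T\<^sup>\<omega>) (e mod n)" by (simp add: iter_T mod_simps)
    qed
    then obtain d where d: "d < n" "alt_at (T\<^sup>\<omega>) (suffix s (T\<^sup>\<omega>)) d"
      by (metis True first_mismatch le_less_trans omega_less_def omega_less_irrefl omega_less_trans)
    define s' where "s' = s + 2 * (d div 2) + 2"
    have s': "s + d < s'" "even (s' + s)" unfolding s'_def by presburger+
    have nm: "nonminimal T t" if "0 < t" "t < s'" "even (s + t)" for t
    proof (cases "t < s")
      case True
      with less.prems(3) that show ?thesis by blast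
    next
      case False
      \<comment> \<open>An even number below \<open>2 * (d div 2) + 2\<close> is at most
        \<open>2 * (d div 2)\<close>, hence at most \<open>d\<close>.\<close>
      then have "even (t - s)" "t - s \<le> d" using that unfolding s'_def by presburger+
      from nonminimal_skip[OF d(2) this] False show ?thesis by simp
    qed
    have "halts w T 7 (mem n s i j f q) (b + 14 * (n - s') + 14 * (if s' < n then n else 0)
        + 7 * d + 14) (galois T)"
    proof (rule test_smaller[OF less.prems(2) d s'_def])
      fix i j q assume "s' < n"
      then show "halts w T 7 (mem n s' i j f q)
          (b + 14 * (n - s') + 14 * (if s' < n then n else 0)) (galois T)"
        using less.hyps[of s' i j q] s' nm less.prems by (simp add: even_add)
    next
      fix s i j q assume "n \<le> s'"
      then show "halts w T 8 (mem n s i j f q)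
          (b + 14 * (n - s') + 14 * (if s' < n then n else 0)) (galois T)"
        using nm less.prems by (auto intro!: assms(4) simp: even_add)
    qed
    moreover have "b + 14 * (n - s') + 14 * (if s' < n then n else 0) + 7 * d + 14
        \<le> b + 14 * (n - s) + 14 * n"
      using s'(1) d(1) by auto
    ultimately show ?thesis by (rule halts_mono)
  qed
qed

lemma two_passes:
  "halts w T 7 (mem n 1 0 0 0 0) (56 * n + 6) (galois T)"
proof -
  have second: "halts w T 8 (mem n s i j 0 q) (28 * n + 6) (galois T)"
    if odds: "\<And>t. 0 < t \<Longrightarrow> t < n \<Longrightarrow> even (1 + t) \<Longrightarrow> nonminimal T t" for s i j q
  proof -
    have last: "halts w T 8 (mem n s i j 1 q) 2 (galois T)"
      if "\<And>t. 0 < t \<Longrightarrow> t < n \<Longrightarrow> even (2 + t) \<Longrightarrow> nonminimal T t" for s i j q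
    proof -
      have "galois T"
        by (rule galois_if_nonminimal[OF ne])
          (metis that odds even_Suc even_add even_numeral len plus_1_eq_Suc)
      then show ?thesis by (simp add: halts_unfold[of 8] halts_unfold[of 5] exec_rules)
    qed
    have "halts w T 7 (mem n 2 i j 1 q) (28 * n + 2) (galois T)"
    proof (cases "2 < n")
      case True
      have "halts w T 7 (mem n 2 i j 1 q) (2 + 14 * (n - 2) + 14 * n) (galois T)"
        by (rule pass[where start = 2]) (use True last in \<open>auto simp: less_2_cases_iff\<close>)
      then show ?thesis by (rule halts_mono) auto
    next
      case False
      then have "n = 2" using n2 by simp
      \<comment> \<open>There is no offset \<open>2\<close> to test; 57 is \<open>28 * 2 + 2\<close>
        less the instruction at \<open>7\<close>.\<close>
      then show ?thesis using halts_mono[OF last, of 57]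
        by (auto simp: halts_unfold[of 7] exec_rules less_2_cases_iff)
    qed
    then show ?thesis
      using n2 by (simp add: halts_unfold[of 8] halts_unfold[of 9] halts_unfold[of 10]
        halts_unfold[of 11] exec_rules)
  qed
  have "halts w T 7 (mem n 1 0 0 0 0) (28 * n + 6 + 14 * (n - 1) + 14 * n) (galois T)"
    by (rule pass[where start = 1]) (use n2 second in auto)
  then show ?thesis by (rule halts_mono) auto
qed

end

section \<open>Initialisation, short words and the final bounds\<close>

lemma program_correct:
  fixes T :: "'a::linorder list"
  assumes "length T < 2 ^ w"
  shows "halts w T 0 (\<lambda>_. 0) (56 * length T + 12) (galois T)"
proof -
  consider "T = []" | "length T = 1" | "2 \<le> length T"
    by (cases T; cases "tl T") auto
  then show ?thesis
  proof cases
    case 1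
    then show ?thesis
      by (simp add: galois_def halts_unfold[of 0] halts_unfold[of "Suc 0"] halts_unfold[of 32]
        prog_nth store_def)
  next
    case 2
    \<comment> \<open>Here \<open>w\<close> may be 1: the constant 1 fits into a cell, and the
      program halts before it loads 2.\<close>
    then have "galois T" "0 < w" using assms by (cases w; auto simp: galois_def)+
    with 2 show ?thesis
      by (simp add: halts_unfold[of 0] halts_unfold[of "Suc 0"] halts_unfold[of 2]
        halts_unfold[of 3] halts_unfold[of 4] halts_unfold[of 5] prog_nth store_def
        flip: numeral_2_eq_2)
  next
    case 3
    have w: "2 < (2::nat) ^ w" using 3 assms by linarith
    have "halts w T 7 ((\<lambda>_. 0)(0 := length T, 4 := 1, 1 := 1, 7 := 2))
        (56 * length T + 6) (galois T)"
      using two_passes[OF refl 3 assms] by (simp add: mem_def fun_upd_twist fun_upd_idem)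
    moreover have "0 < w" "T \<noteq> []" "Suc 0 < length T"
      using 3 assms by (cases w; auto)+
    ultimately show ?thesis
      using w assms
      by (simp add: halts_unfold[of 0] halts_unfold[of "Suc 0"] halts_unfold[of 2]
        halts_unfold[of 3] halts_unfold[of 4] halts_unfold[of 6] prog_nth store_def add.commute
        flip: numeral_2_eq_2)
  qed
qed

theorem theorem25:
  shows "\<exists>(P :: program) (time :: nat \<Rightarrow> nat) (space :: nat \<Rightarrow> nat).
    (\<lambda>n. real (time n)) \<in> O(\<lambda>n. real n) \<and>
    (\<lambda>n. real (space n)) \<in> O(\<lambda>_. 1) \<and>
    decides_within P (galois :: 'a::linorder list \<Rightarrow> bool) time space"
proof (intro exI conjI)
  show "(\<lambda>n. real (56 * n + 12)) \<in> O(\<lambda>n. real n)"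
    \<comment> \<open>68 is \<open>56 + 12\<close>, sufficient from \<open>n = 1\<close> on.\<close>
    by (rule landau_o.bigI[of 68]) (auto simp: eventually_at_top_linorder intro!: exI[of _ 1])
  show "(\<lambda>n. real ((\<lambda>_. 9) n)) \<in> O(\<lambda>_. 1)" by simp
  show "decides_within prog (galois :: 'a list \<Rightarrow> bool) (\<lambda>n. 56 * n + 12) (\<lambda>_. 9)"
    using program_correct unfolding decides_within_def halts_def by blast
qed

end
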